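(* Let $k\in\mathbb{N}$, let $q(x)=(x+b_1)\cdots(x+b_k)$, and let $p$ be either of the following: (i) $p(x)=(x+a_1)\cdots(x+a_k)$ with $0<a_1<b_1<a_2<b_2<\cdots<a_k<b_k$; (ii) $p(x)=(x+a_1)\cdots(x+a_{k+1})$ with $0<a_1<b_1<a_2<b_2<\cdots<a_k<b_k<a_{k+1}$. Then the sequence $\left\{\frac{p(n)}{q(n)}\right\}_{n\in\mathbb{Z}_+}$ is completely alternating.
   Context: $\mathbb{N}=\{1,2,3,\dots\}$ and $\mathbb{Z}_+=\{0,1,2,\dots\}$; all $a_i,b_i$ are real numbers. For $a\in\mathbb{Z}_+$ and $\psi:\mathbb{Z}_+\to\mathbb{R}$, $(\nabla_a\psi)(m)=\psi(m)-\psi(m+a)$. A sequence $\psi:\mathbb{Z}_+\to\mathbb{R}$ is completely alternating if $\nabla_{d_1}\cdots\nabla_{d_n}\psi(m)\leq 0$ for all $n\geq 1$, all $d_1,\dots,d_n\in\mathbb{Z}_+$ (repetitions allowed) and all $m\in\mathbb{Z}_+$. *)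

theory Defs
  imports Complex_Main
begin

definition nabla :: "nat \<Rightarrow> (nat \<Rightarrow> real) \<Rightarrow> nat \<Rightarrow> real" where
  "nabla a \<psi> m = \<psi> m - \<psi> (m + a)"

(* The list ds = [d_1, ..., d_n], n \<ge> 1, is the family of steps, and foldr nabla ds \<psi> is
   nabla d_1 (... (nabla d_n \<psi>)). *)
definition completely_alternating :: "(nat \<Rightarrow> real) \<Rightarrow> bool" where
  "completely_alternating \<psi> \<longleftrightarrow> (\<forall>ds m. ds \<noteq> [] \<longrightarrow> foldr nabla ds \<psi> m \<le> 0)"

end

(* With all b_i > 0, p/q has a partial fraction expansion alpha x + beta - (SUM i. c_i / (x + b_i))
   with alpha, c_i >= 0: multiplying such an expansion by (x + a) / (x + b), where every b_i < a < b,
   keeps the signs of the residues. It remains to see that 1 / (x + b) is completely monotone. Its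
   nabla_d equals d / ((x + b) (x + b + d)), and by the Leibniz rule products inherit nonnegativity of
   the iterated differences up to a given order, so induction on the order applies. *)
theory Submission
  imports Defs
begin

text \<open>Complete monotonicity truncated at order \<open>n\<close>: all iterated differences of
  at most \<open>n\<close> steps are nonnegative. The explicit order is what the induction for the
  reciprocal runs on.\<close>

fun monotone_upto :: "nat \<Rightarrow> (nat \<Rightarrow> real) \<Rightarrow> bool" where
  "monotone_upto 0 f \<longleftrightarrow> (\<forall>m. 0 \<le> f m)"
| "monotone_upto (Suc n) f \<longleftrightarrow> (\<forall>m. 0 \<le> f m) \<and> (\<forall>d. monotone_upto n (nabla d f))"

lemma monotone_upto_nonneg: "monotone_upto n f \<Longrightarrow> 0 \<le> f m"
  by (cases n) auto

lemma monotone_upto_SucD: "monotone_upto (Suc n) f \<Longrightarrow> monotone_upto n f"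
  by (induction n arbitrary: f) auto

lemma monotone_upto_shift: "monotone_upto n f \<Longrightarrow> monotone_upto n (\<lambda>m. f (m + j))"
proof (induction n arbitrary: f)
  case (Suc n)
  have "nabla d (\<lambda>m. f (m + j)) = (\<lambda>m. nabla d f (m + j))" for d
    by (simp add: nabla_def fun_eq_iff add_ac)
  with Suc show ?case by simp
qed simp

lemma monotone_upto_const: "0 \<le> c \<Longrightarrow> monotone_upto n (\<lambda>m. c)"
proof (induction n arbitrary: c)
  case (Suc n)
  have "nabla d (\<lambda>m. c) = (\<lambda>m. 0)" for d
    by (simp add: nabla_def fun_eq_iff)
  with Suc show ?case by simp
qed simp

lemma monotone_upto_add:
  "monotone_upto n f \<Longrightarrow> monotone_upto n g \<Longrightarrow> monotone_upto n (\<lambda>m. f m + g m)"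
proof (induction n arbitrary: f g)
  case (Suc n)
  have "nabla d (\<lambda>m. f m + g m) = (\<lambda>m. nabla d f m + nabla d g m)" for d
    by (simp add: nabla_def fun_eq_iff)
  with Suc show ?case by simp
qed simp

text \<open>The discrete Leibniz rule writes the difference of a product as a sum of two products,
  each with one factor differenced and the other undifferenced, possibly shifted. Undifferenced
  factors drop from order \<open>Suc n\<close> to \<open>n\<close>, so the induction hypothesis
  applies to both products.\<close>

lemma monotone_upto_mult:
  "monotone_upto n f \<Longrightarrow> monotone_upto n g \<Longrightarrow> monotone_upto n (\<lambda>m. f m * g m)"
proof (induction n arbitrary: f g)
  case (Suc n)
  have "nabla d (\<lambda>m. f m * g m) = (\<lambda>m. nabla d f m * g m + f (m + d) * nabla d g m)" for d
    by (simp add: nabla_def fun_eq_iff algebra_simps)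
  moreover have "monotone_upto n (\<lambda>m. nabla d f m * g m + f (m + d) * nabla d g m)" for d
    using Suc.prems
    by (intro monotone_upto_add Suc.IH monotone_upto_shift monotone_upto_SucD[of n f]
        monotone_upto_SucD[of n g]) auto
  ultimately show ?case
    using Suc.prems by simp
qed simp

lemma monotone_upto_sum:
  assumes "\<And>i. i \<in> I \<Longrightarrow> monotone_upto n (f i)"
  shows "monotone_upto n (\<lambda>m. \<Sum>i\<in>I. f i m)"
  using assms
  by (induction I rule: infinite_finite_induct)
    (simp_all add: monotone_upto_const monotone_upto_add)

text \<open>A difference of the reciprocal is a constant times two reciprocals of the same kind, now
  needed only at order \<open>n\<close>. The induction leaves \<open>b\<close> arbitrary because the
  second one has parameter \<open>b + d\<close>.\<close>

lemma monotone_upto_reciprocal: "0 < b \<Longrightarrow> monotone_upto n (\<lambda>m. 1 / (real m + b))"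
proof (induction n arbitrary: b)
  case (Suc n)
  have "nabla d (\<lambda>m. 1 / (real m + b))
      = (\<lambda>m. real d * (1 / (real m + b) * (1 / (real m + (b + real d)))))" for d
  proof
    fix m
    have "real m + b \<noteq> 0" "real m + (b + real d) \<noteq> 0"
      using Suc.prems by linarith+
    then show "nabla d (\<lambda>m. 1 / (real m + b)) m
        = real d * (1 / (real m + b) * (1 / (real m + (b + real d))))"
      by (simp add: nabla_def divide_simps)
  qed
  moreover have "monotone_upto n
      (\<lambda>m. real d * (1 / (real m + b) * (1 / (real m + (b + real d)))))" for d
    using Suc.prems by (intro monotone_upto_mult monotone_upto_const Suc.IH) auto
  ultimately show ?case
    using Suc.prems by simp
qed simp

text \<open>\<open>foldr\<close> applies the last step of \<open>ds\<close> first, while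
  \<open>monotone_upto\<close> unfolds at the innermost difference; hence the induction from the
  rear of the list.\<close>

lemma foldr_nabla_nonneg: "monotone_upto (length ds) f \<Longrightarrow> 0 \<le> foldr nabla ds f m"
  by (induction ds arbitrary: f rule: rev_induct) simp_all

lemma foldr_nabla_minus: "foldr nabla ds (\<lambda>m. - f m) = (\<lambda>m. - foldr nabla ds f m)"
  by (induction ds) (simp_all add: nabla_def fun_eq_iff)

text \<open>Since \<open>ds\<close> is nonempty, its innermost difference can be split off. After a
  change of sign, the remaining differences act on a sequence that is monotone to every
  order.\<close>

lemma completely_alternatingI:
  assumes "\<And>n d. monotone_upto n (\<lambda>m. - nabla d f m)"
  shows "completely_alternating f"
  unfolding completely_alternating_def
proof (intro allI impI)
  fix ds :: "nat list" and m
  assume "ds \<noteq> []"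
  then obtain es d where ds: "ds = es @ [d]"
    by (metis rev_exhaust)
  have "0 \<le> foldr nabla es (\<lambda>m. - nabla d f m) m"
    by (intro foldr_nabla_nonneg assms)
  then show "foldr nabla ds f m \<le> 0"
    by (simp add: ds foldr_nabla_minus)
qed

text \<open>Under the negated difference \<open>\<beta>\<close> cancels, so its sign is free; the
  linear term leaves the constant \<open>\<alpha> * d\<close>, and each fraction leaves
  \<open>c i\<close> times a difference of a reciprocal.\<close>

lemma completely_alternating_partial_fractions:
  fixes \<alpha> \<beta> :: real and b c :: "'i \<Rightarrow> real"
  assumes "0 \<le> \<alpha>" and "\<And>i. i \<in> I \<Longrightarrow> 0 \<le> c i" and "\<And>i. i \<in> I \<Longrightarrow> 0 < b i"
  shows "completely_alternating (\<lambda>n. \<alpha> * real n + \<beta> - (\<Sum>i\<in>I. c i / (real n + b i)))"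
    (is "completely_alternating ?f")
proof (rule completely_alternatingI)
  fix n d
  have "(\<lambda>m. - nabla d ?f m)
      = (\<lambda>m. \<alpha> * real d + (\<Sum>i\<in>I. c i * nabla d (\<lambda>m. 1 / (real m + b i)) m))"
    by (simp add: nabla_def fun_eq_iff right_diff_distrib sum_subtractf algebra_simps)
  moreover have "monotone_upto n (nabla d (\<lambda>m. 1 / (real m + b i)))" if "i \<in> I" for i
    using monotone_upto_reciprocal[of "b i" "Suc n"] assms(3)[OF that] by simp
  ultimately show "monotone_upto n (\<lambda>m. - nabla d ?f m)"
    using assms
    by (auto intro!: monotone_upto_add monotone_upto_const monotone_upto_sum monotone_upto_mult)
qed

text \<open>Chaining the inequalities places every earlier \<open>b i\<close> below the next zero
  parameter. This fixes the sign of the factors \<open>A - b i\<close> in the residues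
  below.\<close>

lemma interlacing_less:
  fixes a b :: "nat \<Rightarrow> 'a::order"
  assumes "\<forall>i\<in>{1..k}. a i < b i" and "\<forall>i\<in>{1..k}. b i < a (i + 1)" and "i \<in> {1..k}"
  shows "b i < a (k + 1)"
  using assms
proof (induction k)
  case (Suc k)
  show ?case
  proof (cases "i = Suc k")
    case False
    then have "b i < a (k + 1)"
      using Suc by auto
    also have "\<dots> < b (Suc k)"
      using Suc.prems by auto
    also have "\<dots> < a (Suc k + 1)"
      using Suc.prems by auto
    finally show ?thesis .
  qed (use Suc.prems in auto)
qed simp

lemma interlacing_pos:
  fixes a b :: "nat \<Rightarrow> 'a::{order, zero}"
  assumes "0 < a 1" and "\<forall>i\<in>{1..k}. a i < b i" and "\<forall>i\<in>{1..<k}. b i < a (i + 1)"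
    and "i \<in> {1..k}"
  shows "0 < b i"
  using assms(4)
proof (induction i)
  case (Suc i)
  have "0 < a (Suc i)"
  proof (cases "i = 0")
    case False
    then have "0 < b i" "b i < a (i + 1)"
      using Suc assms(3) by auto
    then show ?thesis
      by (simp add: less_trans)
  qed (use assms(1) in simp)
  also have "a (Suc i) < b (Suc i)"
    using Suc.prems assms(2) by blast
  finally show ?case .
qed simp

text \<open>Induction on \<open>k\<close>, multiplying by \<open>(x + A) / (x + B)\<close> with
  \<open>b i < A < B\<close>. The constant term stays 1 because numerator and denominator have equal
  degree; \<open>0 \<le> x\<close> keeps all denominators nonzero.\<close>

lemma interlacing_partial_fractions:
  fixes a b :: "nat \<Rightarrow> real"
  assumes "0 < a 1" and "\<forall>i\<in>{1..k}. a i < b i" and "\<forall>i\<in>{1..<k}. b i < a (i + 1)"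
  shows "\<exists>c. (\<forall>i\<in>{1..k}. 0 \<le> c i) \<and>
    (\<forall>x\<ge>0. (\<Prod>i=1..k. x + a i) / (\<Prod>i=1..k. x + b i) = 1 - (\<Sum>i=1..k. c i / (x + b i)))"
  using assms
proof (induction k)
  case (Suc k)
  then obtain c where c: "\<forall>i\<in>{1..k}. 0 \<le> c i"
    and eq: "\<And>x. 0 \<le> x \<Longrightarrow>
      (\<Prod>i=1..k. x + a i) / (\<Prod>i=1..k. x + b i) = 1 - (\<Sum>i=1..k. c i / (x + b i))"
    by auto
  define A B where "A = a (Suc k)" and "B = b (Suc k)"
  have AB: "A < B"
    using Suc.prems by (simp add: A_def B_def)
  have less: "b i < A" if "i \<in> {1..k}" for i
    using interlacing_less[of k a b i] Suc.prems that by (auto simp: A_def)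
  have pos: "0 < b i" if "i \<in> {1..Suc k}" for i
    using interlacing_pos[OF Suc.prems that] .
  have "0 < B"
    using pos[of "Suc k"] by (simp add: B_def)
  \<comment> \<open>These are the negated residues of the new quotient. At \<open>-B\<close> it is
    \<open>B - A\<close> times the old expansion evaluated at \<open>-B\<close>; at
    \<open>-b i\<close> the old coefficient is multiplied by the value of
    \<open>(x + A) / (x + B)\<close> there.\<close>
  define c' where "c' i = (if i = Suc k then (B - A) * (1 + (\<Sum>j=1..k. c j / (B - b j)))
     else c i * (A - b i) / (B - b i))" for i
  have "0 \<le> c' i" if "i \<in> {1..Suc k}" for i
  proof (cases "i = Suc k")
    case True
    have "0 \<le> c j / (B - b j)" if "j \<in> {1..k}" for j
      using c less[OF that] AB that by auto
    then have "0 \<le> (\<Sum>j=1..k. c j / (B - b j))"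
      by (rule sum_nonneg)
    with True AB show ?thesis
      by (simp add: c'_def)
  next
    case False
    then have "i \<in> {1..k}"
      using that by auto
    with False c less[of i] AB show ?thesis
      by (simp add: c'_def)
  qed
  moreover have "(\<Prod>i=1..Suc k. x + a i) / (\<Prod>i=1..Suc k. x + b i)
      = 1 - (\<Sum>i=1..Suc k. c' i / (x + b i))" if "0 \<le> x" for x
  proof -
    have nz: "x + B \<noteq> 0"
      using that \<open>0 < B\<close> by simp
    \<comment> \<open>Partial fractions for the two distinct poles \<open>-b i\<close> and
      \<open>-B\<close>. Summed over \<open>i\<close>, the second terms form the part of
      \<open>c' (Suc k)\<close> that comes from the old fractions.\<close>
    have split: "c i / (x + b i) * ((x + A) / (x + B))
        = c' i / (x + b i) + (B - A) * (c i / (B - b i)) / (x + B)"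
      if i: "i \<in> {1..k}" for i
    proof -
      have "x + b i \<noteq> 0" "B - b i \<noteq> 0"
        using pos[of i] less[OF i] AB i \<open>0 \<le> x\<close> by auto
      moreover have "c' i = c i * (A - b i) / (B - b i)"
        using i by (simp add: c'_def)
      ultimately show ?thesis
        using nz by (simp add: divide_simps) algebra
    qed
    have "(\<Sum>i=1..k. c i / (x + b i)) * ((x + A) / (x + B))
        = (\<Sum>i=1..k. c' i / (x + b i)) + (B - A) * (\<Sum>i=1..k. c i / (B - b i)) / (x + B)"
      unfolding sum_distrib_right sum_distrib_left sum_divide_distrib sum.distrib[symmetric]
      by (intro sum.cong refl split)
    moreover have "(x + A) / (x + B) = 1 - (B - A) / (x + B)"
      using nz by (simp add: field_simps)
    moreover have "c' (Suc k) / (x + B)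
        = (B - A) / (x + B) + (B - A) * (\<Sum>i=1..k. c i / (B - b i)) / (x + B)"
      by (simp add: c'_def distrib_left add_divide_distrib)
    ultimately have "(1 - (\<Sum>i=1..k. c i / (x + b i))) * ((x + A) / (x + B))
        = 1 - ((\<Sum>i=1..k. c' i / (x + b i)) + c' (Suc k) / (x + B))"
      unfolding left_diff_distrib by linarith
    moreover have "(\<Prod>i=1..Suc k. x + a i) / (\<Prod>i=1..Suc k. x + b i)
        = (\<Prod>i=1..k. x + a i) / (\<Prod>i=1..k. x + b i) * ((x + A) / (x + B))"
      by (simp add: A_def B_def)
    moreover have "(\<Sum>i=1..Suc k. c' i / (x + b i))
        = (\<Sum>i=1..k. c' i / (x + b i)) + c' (Suc k) / (x + B)"
      by (simp add: B_def)
    ultimately show ?thesis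
      by (simp only: eq[OF that])
  qed
  ultimately show ?case
    by blast
qed simp

theorem corollary3p4:
  fixes k :: nat and a b :: "nat \<Rightarrow> real" and p q :: "real \<Rightarrow> real"
  assumes "k \<ge> 1"
    and "q = (\<lambda>x. \<Prod>i=1..k. (x + b i))"
    and "(p = (\<lambda>x. \<Prod>i=1..k. (x + a i)) \<and>
          0 < a 1 \<and> (\<forall>i\<in>{1..k}. a i < b i) \<and> (\<forall>i\<in>{1..<k}. b i < a (i + 1)))
       \<or> (p = (\<lambda>x. \<Prod>i=1..k+1. (x + a i)) \<and>
          0 < a 1 \<and> (\<forall>i\<in>{1..k}. a i < b i) \<and> (\<forall>i\<in>{1..k}. b i < a (i + 1)))"
  shows "completely_alternating (\<lambda>n. p (real n) / q (real n))"
proof -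
  \<comment> \<open>Case (ii) contains the inequalities of case (i), so the expansion of the first
    \<open>k\<close> factors serves both cases.\<close>
  have ab: "0 < a 1" "\<forall>i\<in>{1..k}. a i < b i" "\<forall>i\<in>{1..<k}. b i < a (i + 1)"
    using assms(3) by auto
  obtain c where c: "\<forall>i\<in>{1..k}. 0 \<le> c i"
    and eq: "\<And>x. 0 \<le> x \<Longrightarrow>
      (\<Prod>i=1..k. x + a i) / (\<Prod>i=1..k. x + b i) = 1 - (\<Sum>i=1..k. c i / (x + b i))"
    using interlacing_partial_fractions[OF ab] by blast
  have pos: "0 < b i" if "i \<in> {1..k}" for i
    using interlacing_pos[OF ab that] .
  from assms(3) show ?thesis
  proof (elim disjE conjE)
    assume p: "p = (\<lambda>x. \<Prod>i=1..k. (x + a i))"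
    have "completely_alternating (\<lambda>n. 0 * real n + 1 - (\<Sum>i=1..k. c i / (real n + b i)))"
      using c pos by (intro completely_alternating_partial_fractions) auto
    then show ?thesis
      by (simp add: p assms(2) eq del: One_nat_def)
  next
    assume p: "p = (\<lambda>x. \<Prod>i=1..k+1. (x + a i))" and less: "\<forall>i\<in>{1..k}. b i < a (i + 1)"
    define A where "A = a (k + 1)"
    \<comment> \<open>Multiplying by the extra factor turns \<open>c i / (x + b i)\<close> into
      \<open>c i + c i * (A - b i) / (x + b i)\<close>. The constants \<open>c i\<close> go into
      \<open>\<beta>\<close>, and the leading 1 becomes \<open>x + A\<close>, so
      \<open>\<alpha> = 1\<close>.\<close>
    define c' where "c' i = c i * (A - b i)" for i
    have "0 \<le> c' i" if "i \<in> {1..k}" for i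
      using interlacing_less[OF ab(2) less that] c that by (simp add: c'_def A_def)
    then have "completely_alternating
        (\<lambda>n. 1 * real n + (A - (\<Sum>i=1..k. c i)) - (\<Sum>i=1..k. c' i / (real n + b i)))"
      using pos by (intro completely_alternating_partial_fractions) auto
    moreover have "p (real n) / q (real n)
        = 1 * real n + (A - (\<Sum>i=1..k. c i)) - (\<Sum>i=1..k. c' i / (real n + b i))" for n
    proof -
      have "c i / (real n + b i) * (real n + A) = c i + c' i / (real n + b i)"
        if "i \<in> {1..k}" for i
        using pos[OF that] by (simp add: c'_def field_simps)
      then have "(\<Sum>i=1..k. c i / (real n + b i)) * (real n + A)
          = (\<Sum>i=1..k. c i) + (\<Sum>i=1..k. c' i / (real n + b i))"
        unfolding sum_distrib_right sum.distrib[symmetric] by (intro sum.cong refl)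
      moreover have "p (real n) / q (real n)
          = (\<Prod>i=1..k. real n + a i) / (\<Prod>i=1..k. real n + b i) * (real n + A)"
        by (simp add: p assms(2) A_def)
      ultimately show ?thesis
        by (simp only: eq[OF of_nat_0_le_iff] left_diff_distrib) simp
    qed
    ultimately show ?thesis
      by simp
  qed
qed

end
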